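(* Exact thermodynamic morphisms define a category $\mathbf{ThermCont}$: the objects are open continuum thermodynamic systems, the morphisms are exact thermodynamic morphisms, composition is componentwise composition of the maps $(T_\Phi,P^e_\Phi,P^f_\Phi)$, and identities are given by identity maps.
   Context: Let $\Omega\subset\mathbb R^d$ be a bounded Lipschitz domain with outward unit normal $n$, let $U\subset\mathbb R^m$ be nonempty, open and convex, and let $\psi:\overline\Omega\times U\to\mathbb R$ be a $C^2$ storage density such that $u\mapsto\psi(x,u)$ is convex on $U$ for each $x\in\overline\Omega$. The admissible field space is $\mathcal X:=\{u\in H^1(\Omega;\mathbb R^m): u(x)\in U\text{ for a.e. }x\in\Omega,\ \psi(\cdot,u(\cdot))\in L^1(\Omega)\}$. The free energy is $\mathcal F[u]:=\int_\Omega\psi(x,u(x))\,dx$, and the thermodynamic potential is $\mu[u](x):=D_u\psi(x,u(x))$. An open constitutive structure consists of: a reversible flux $J^{\mathrm{rev}}:\mathcal X\to L^1(\Omega;\mathbb R^{m\times d})$; a dissipative flux $J^{\mathrm{diss}}:\mathcal X\to L^1(\Omega;\mathbb R^{m\times d})$; a source $R:\mathcal X\to L^1(\Omega;\mathbb R^m)$; boundary port spaces $Y_e,Y_f$, trace maps $e:\mathcal X\to Y_e$, $f:\mathcal X\to Y_f$, and a continuous duality pairing $\langle\cdot,\cdot\rangle_Y:Y_e\times Y_f\to\mathbb R$. The boundary exchange is $\mathcal B[u]:=\langle e[u],f[u]\rangle_Y$. Divergences of $\mathbb R^{m\times d}$-valued fields are taken row-wise. The structure is thermodynamically admissible if there exist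 maps $q^{\mathrm{rev}},q^{\mathrm{diss}}:\mathcal X\to L^1(\Omega;\mathbb R^d)$ and $\sigma:\mathcal X\to L^1(\Omega)$ such that for every sufficiently smooth $u\in\mathcal X$: (1) $\mu[u]\cdot\operatorname{div}J^{\mathrm{rev}}[u]=\operatorname{div}q^{\mathrm{rev}}[u]$ in $\mathscr D'(\Omega)$; (2) $\mu[u]\cdot\operatorname{div}J^{\mathrm{diss}}[u]=\operatorname{div}q^{\mathrm{diss}}[u]+\sigma[u]$ in $\mathscr D'(\Omega)$; (3) $\sigma[u](x)\ge0$ for a.e. $x\in\Omega$; (4) $-\int_{\partial\Omega}(q^{\mathrm{rev}}[u]+q^{\mathrm{diss}}[u])\cdot n\,dS=\mathcal B[u]$; and the source contribution $\mathcal S[u]:=\int_\Omega\mu[u]\cdot R[u]\,dx$ is finite. The dissipation is $\mathcal D[u]:=\int_\Omega\sigma[u]\,dx$. An open continuum thermodynamic system is a tuple $\mathsf T=(\Omega,U,\mathcal X,\psi,\mu,J^{\mathrm{rev}},J^{\mathrm{diss}},R,Y_e,Y_f,e,f)$ in which $\Omega$ is a bounded Lipschitz domain, $U$ is a nonempty open convex state set, $\psi$ is a $C^2$ storage density convex in its second argument, $\mathcal X$ is the admissible field space and $\mu$ the thermodynamic potential determined by $(\Omega,U,\psi)$, and $J^{\mathrm{rev}},J^{\mathrm{diss}},R,Y_e,Y_f,e,f$ (with the pairing $\langle\cdot,\cdot\rangle_Y$) form a thermodynamically admissible open constitutive structure. A smooth admissible trajectory of $\mathsf T$ on $[0,T]$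 is a map $u:[0,T]\to\mathcal X$ that is sufficiently regular in space and time for all terms in the evolution equation $\partial_tu+\operatorname{div}(J^{\mathrm{rev}}[u]+J^{\mathrm{diss}}[u])=R[u]$, in the boundary exchange $\mathcal B[u]$, in the thermodynamic admissibility conditions on $q^{\mathrm{rev}}[u],q^{\mathrm{diss}}[u],\sigma[u]$, and in the source contribution $\mathcal S[u]$ to be meaningful, and which satisfies almost everywhere $\partial_tu+\operatorname{div}(J^{\mathrm{rev}}[u]+J^{\mathrm{diss}}[u])=R[u]$ in $\Omega\times(0,T)$. An exact thermodynamic morphism $\Phi:\mathsf T_1\to\mathsf T_2$ (quantities of $\mathsf T_i$ carry the index $i$) consists of maps $T_\Phi:\mathcal X_1\to\mathcal X_2$, $P^e_\Phi:Y_{e,1}\to Y_{e,2}$, $P^f_\Phi:Y_{f,1}\to Y_{f,2}$ such that for every smooth admissible trajectory $u$ of $\mathsf T_1$ the transformed trajectory $u^\Phi:=T_\Phi u$ is a smooth admissible trajectory of $\mathsf T_2$, and $\mathcal F_2[u^\Phi(t)]=\mathcal F_1[u(t)]$, $\mathcal D_2[u^\Phi(t)]=\mathcal D_1[u(t)]$, $\mathcal S_2[u^\Phi(t)]=\mathcal S_1[u(t)]$, $e_2[u^\Phi(t)]=P^e_\Phi e_1[u(t)]$, $f_2[u^\Phi(t)]=P^f_\Phi f_1[u(t)]$, and $\langle P^e_\Phi\eta,P^f_\Phi\zeta\rangle_{Y_2}=\langle\eta,\zeta\rangle_{Y_1}$ for all $(\eta,\zeta)\in Y_{e,1}\times Y_{f,1}$.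 *)

theory Defs
  imports "HOL-Analysis.Analysis" "HOL-Algebra.Module" "HOL-Library.Extended_Nat"
begin

text \<open>
  The systems below live in all dimensions at once, so the space of families of reals indexed by
  \<open>I\<close> is the set \<open>I \<rightarrow>\<^sub>E UNIV\<close> of extensional functions, with the library's product topology and
  product measure; \<open>\<real>\<^sup>n\<close> is the case \<open>I = {..<n}\<close>.
\<close>

section \<open>Calculus on finite-dimensional coordinate spaces\<close>

abbreviation euc :: "'i set \<Rightarrow> ('i \<Rightarrow> real) topology" where
  "euc I \<equiv> product_topology (\<lambda>_. euclideanreal) I"

definition partial :: "'i \<Rightarrow> (('i \<Rightarrow> real) \<Rightarrow> real) \<Rightarrow> ('i \<Rightarrow> real) \<Rightarrow> real" where
  "partial i f = (\<lambda>x. deriv (\<lambda>s. f (x(i := s))) (x i))"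

definition partials :: "'i list \<Rightarrow> (('i \<Rightarrow> real) \<Rightarrow> real) \<Rightarrow> ('i \<Rightarrow> real) \<Rightarrow> real" where
  "partials js f = foldr partial js f"

text \<open>Class \<open>C\<^sup>k\<close> on the open set \<open>S\<close> of \<open>\<real>\<^sup>I\<close>; \<open>k = \<infinity>\<close> is allowed.\<close>

definition Ck :: "'i set \<Rightarrow> enat \<Rightarrow> ('i \<Rightarrow> real) set \<Rightarrow> (('i \<Rightarrow> real) \<Rightarrow> real) \<Rightarrow> bool" where
  "Ck I k S f \<longleftrightarrow>
     (\<forall>js. set js \<subseteq> I \<and> enat (length js) \<le> k \<longrightarrow>
        continuous_map (subtopology (euc I) S) euclideanreal (partials js f)) \<and>
     (\<forall>js. set js \<subseteq> I \<and> enat (length js) < k \<longrightarrow>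
        (\<forall>i\<in>I. \<forall>x\<in>S. (\<lambda>s. partials js f (x(i := s))) differentiable (at (x i))))"

text \<open>
  \<open>f\<close> is \<open>C\<^sup>k\<close> on the open set \<open>S\<close>, is continuous on \<open>S'\<close> (a set between \<open>S\<close> and its closure),
  and its derivatives up to order \<open>k\<close> extend continuously to \<open>S'\<close>.
\<close>

definition Ck_upto ::
  "'i set \<Rightarrow> enat \<Rightarrow> ('i \<Rightarrow> real) set \<Rightarrow> ('i \<Rightarrow> real) set \<Rightarrow> (('i \<Rightarrow> real) \<Rightarrow> real) \<Rightarrow> bool" where
  "Ck_upto I k S S' f \<longleftrightarrow>
     Ck I k S f \<and> continuous_map (subtopology (euc I) S') euclideanreal f \<and>
     (\<forall>js. set js \<subseteq> I \<and> enat (length js) \<le> k \<longrightarrow>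
        (\<exists>g. continuous_map (subtopology (euc I) S') euclideanreal g \<and>
             (\<forall>x\<in>S. g x = partials js f x)))"

type_synonym pt = "nat \<Rightarrow> real"

definition test_functions :: "nat \<Rightarrow> pt set \<Rightarrow> (pt \<Rightarrow> real) set" where
  "test_functions d \<Omega> =
     {\<phi>. Ck {..<d} \<infinity> ({..<d} \<rightarrow>\<^sub>E UNIV) \<phi> \<and>
         (\<exists>K. compactin (euc {..<d}) K \<and> K \<subseteq> \<Omega> \<and> (\<forall>x\<in>({..<d} \<rightarrow>\<^sub>E UNIV) - K. \<phi> x = 0))}"

definition convex_comb :: "nat \<Rightarrow> real \<Rightarrow> pt \<Rightarrow> pt \<Rightarrow> pt" where
  "convex_comb m t u v = (\<lambda>a\<in>{..<m}. (1 - t) * u a + t * v a)"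

definition open_convex_state_set :: "nat \<Rightarrow> pt set \<Rightarrow> bool" where
  "open_convex_state_set m U \<longleftrightarrow>
     U \<noteq> {} \<and> openin (euc {..<m}) U \<and>
     (\<forall>u\<in>U. \<forall>v\<in>U. \<forall>t\<in>{0..1}. convex_comb m t u v \<in> U)"

section \<open>Bounded Lipschitz domains, outward normal and surface measure\<close>

text \<open>
  Near each boundary point, in coordinates \<open>y\<close> with respect to some orthonormal basis
  \<open>b 0, \<dots>, b (d - 1)\<close>, the domain is the part of a ball lying above the graph of a Lipschitz function
  of the first \<open>d - 1\<close> coordinates.
\<close>

definition lipschitz_domain :: "nat \<Rightarrow> pt set \<Rightarrow> bool" where
  "lipschitz_domain d \<Omega> \<longleftrightarrow>
     d \<ge> 1 \<and> \<Omega> \<noteq> {} \<and> openin (euc {..<d}) \<Omega> \<and> connectedin (euc {..<d}) \<Omega> \<and>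
     (\<exists>B. \<forall>x\<in>\<Omega>. L2_set x {..<d} \<le> B) \<and>
     (\<forall>p \<in> euc {..<d} frontier_of \<Omega>. \<exists>(b :: nat \<Rightarrow> pt) (\<gamma> :: pt \<Rightarrow> real) L r.
        r > 0 \<and>
        (\<forall>i<d. \<forall>j<d. (\<Sum>k<d. b i k * b j k) = (if i = j then 1 else 0)) \<and>
        (\<forall>z \<in> {..<d - 1} \<rightarrow>\<^sub>E UNIV. \<forall>w \<in> {..<d - 1} \<rightarrow>\<^sub>E UNIV.
           \<bar>\<gamma> z - \<gamma> w\<bar> \<le> L * L2_set (\<lambda>i. z i - w i) {..<d - 1}) \<and>
        (\<forall>x \<in> {..<d} \<rightarrow>\<^sub>E UNIV. L2_set (\<lambda>i. x i - p i) {..<d} < r \<longrightarrow>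
           (let y = (\<lambda>i. \<Sum>k<d. b i k * (x k - p k))
            in x \<in> \<Omega> \<longleftrightarrow> y (d - 1) > \<gamma> (restrict y {..<d - 1}))))"

text \<open>
  \<open>\<nu>\<close> is the outward unit normal at the boundary point \<open>p\<close> when the domain is asymptotic at \<open>p\<close> to
  the half-space \<open>(x - p) \<bullet> \<nu> < 0\<close>. Such a \<open>\<nu>\<close> is unique, and it exists wherever the local Lipschitz
  graph is differentiable, hence almost everywhere on the boundary; elsewhere the value is 0.
\<close>

definition is_outward_normal :: "nat \<Rightarrow> pt set \<Rightarrow> pt \<Rightarrow> pt \<Rightarrow> bool" where
  "is_outward_normal d \<Omega> p \<nu> \<longleftrightarrow>
     \<nu> \<in> {..<d} \<rightarrow>\<^sub>E UNIV \<and> L2_set \<nu> {..<d} = 1 \<and>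
     (\<forall>\<epsilon>>0. \<exists>r>0. \<forall>x \<in> {..<d} \<rightarrow>\<^sub>E UNIV.
        L2_set (\<lambda>i. x i - p i) {..<d} < r \<longrightarrow>
          ((\<Sum>i<d. (x i - p i) * \<nu> i) < - \<epsilon> * L2_set (\<lambda>i. x i - p i) {..<d} \<longrightarrow> x \<in> \<Omega>) \<and>
          ((\<Sum>i<d. (x i - p i) * \<nu> i) > \<epsilon> * L2_set (\<lambda>i. x i - p i) {..<d} \<longrightarrow> x \<notin> \<Omega>))"

definition outward_normal :: "nat \<Rightarrow> pt set \<Rightarrow> pt \<Rightarrow> pt" where
  "outward_normal d \<Omega> p =
     (if \<exists>\<nu>. is_outward_normal d \<Omega> p \<nu> then THE \<nu>. is_outward_normal d \<Omega> p \<nu> else (\<lambda>_. 0))"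

definition ediameter :: "nat \<Rightarrow> pt set \<Rightarrow> ennreal" where
  "ediameter d C = (SUP x\<in>C. SUP y\<in>C. ennreal (L2_set (\<lambda>i. x i - y i) {..<d}))"

text \<open>
  The surface measure is the \<open>(d - 1)\<close>-dimensional Hausdorff measure, with the factor
  \<open>unit_ball_vol s / 2 ^ s\<close> that makes it agree with Lebesgue measure on \<open>s\<close>-dimensional subspaces
  (counting measure for \<open>s = 0\<close>).
\<close>

definition hausdorff_outer :: "nat \<Rightarrow> nat \<Rightarrow> pt set \<Rightarrow> ennreal" where
  "hausdorff_outer d s A =
     (SUP \<delta>\<in>{0::real<..}.
        INF C\<in>{C :: nat \<Rightarrow> pt set.
                 (\<forall>j. C j \<subseteq> ({..<d} \<rightarrow>\<^sub>E UNIV) \<and> ediameter d (C j) \<le> ennreal \<delta>) \<and> A \<subseteq> (\<Union>j. C j)}.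
          (\<Sum>j. if C j = {} then 0
                else ennreal (unit_ball_vol (real s) / 2 ^ s) * ediameter d (C j) ^ s))"

definition hausdorff_measure :: "nat \<Rightarrow> nat \<Rightarrow> pt measure" where
  "hausdorff_measure d s =
     measure_of ({..<d} \<rightarrow>\<^sub>E UNIV)
       (lambda_system ({..<d} \<rightarrow>\<^sub>E UNIV) (Pow ({..<d} \<rightarrow>\<^sub>E UNIV)) (hausdorff_outer d s))
       (hausdorff_outer d s)"

definition boundary_flux :: "nat \<Rightarrow> pt set \<Rightarrow> (pt \<Rightarrow> pt) \<Rightarrow> real" where
  "boundary_flux d \<Omega> q =
     set_lebesgue_integral (hausdorff_measure d (d - 1)) (euc {..<d} frontier_of \<Omega>)
       (\<lambda>x. \<Sum>i<d. q x i * outward_normal d \<Omega> x i)"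

section \<open>Function classes, weak derivatives and weak divergences\<close>

abbreviation leb :: "nat \<Rightarrow> pt set \<Rightarrow> pt measure" where
  "leb d \<Omega> \<equiv> restrict_space (completion (Pi\<^sub>M {..<d} (\<lambda>_. lborel))) \<Omega>"

text \<open>
  Elements of Lebesgue and Sobolev spaces are genuine almost-everywhere classes. \<open>K\<close> indexes the
  components of the field: \<open>{..<m}\<close> and \<open>{..<d}\<close> for vector fields, \<open>{..<m} \<times> {..<d}\<close> for matrix
  fields, and \<open>UNIV :: unit set\<close> for scalar fields.
\<close>

type_synonym 'k field_class = "(pt \<Rightarrow> 'k \<Rightarrow> real) set"

abbreviation meas_fields :: "nat \<Rightarrow> pt set \<Rightarrow> 'k set \<Rightarrow> (pt \<Rightarrow> 'k \<Rightarrow> real) set" where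
  "meas_fields d \<Omega> K \<equiv> measurable (leb d \<Omega>) (Pi\<^sub>M K (\<lambda>_. borel))"

definition ae_class :: "nat \<Rightarrow> pt set \<Rightarrow> 'k set \<Rightarrow> (pt \<Rightarrow> 'k \<Rightarrow> real) \<Rightarrow> 'k field_class" where
  "ae_class d \<Omega> K f = {g \<in> meas_fields d \<Omega> K. AE x in leb d \<Omega>. g x = f x}"

definition rep :: "'k field_class \<Rightarrow> pt \<Rightarrow> 'k \<Rightarrow> real" where
  "rep c = (SOME f. f \<in> c)"

definition L1 :: "nat \<Rightarrow> pt set \<Rightarrow> 'k set \<Rightarrow> 'k field_class set" where
  "L1 d \<Omega> K =
     {ae_class d \<Omega> K f | f. f \<in> meas_fields d \<Omega> K \<and> (\<forall>k\<in>K. integrable (leb d \<Omega>) (\<lambda>x. f x k))}"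

definition square_integrable :: "nat \<Rightarrow> pt set \<Rightarrow> (pt \<Rightarrow> real) \<Rightarrow> bool" where
  "square_integrable d \<Omega> f \<longleftrightarrow>
     f \<in> borel_measurable (leb d \<Omega>) \<and> integrable (leb d \<Omega>) (\<lambda>x. (f x)\<^sup>2)"

definition is_weak_partial :: "nat \<Rightarrow> pt set \<Rightarrow> nat \<Rightarrow> (pt \<Rightarrow> real) \<Rightarrow> (pt \<Rightarrow> real) \<Rightarrow> bool" where
  "is_weak_partial d \<Omega> i f g \<longleftrightarrow>
     (\<forall>\<phi>\<in>test_functions d \<Omega>.
        (\<integral>x. f x * partial i \<phi> x \<partial>leb d \<Omega>) = - (\<integral>x. g x * \<phi> x \<partial>leb d \<Omega>))"

definition H1_function :: "nat \<Rightarrow> pt set \<Rightarrow> (pt \<Rightarrow> real) \<Rightarrow> bool" where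
  "H1_function d \<Omega> f \<longleftrightarrow>
     square_integrable d \<Omega> f \<and>
     (\<forall>i<d. \<exists>g. square_integrable d \<Omega> g \<and> is_weak_partial d \<Omega> i f g)"

text \<open>The distributional divergence of \<open>q\<close> is the locally integrable function \<open>g\<close>.\<close>

definition is_weak_div :: "nat \<Rightarrow> pt set \<Rightarrow> (pt \<Rightarrow> nat \<Rightarrow> real) \<Rightarrow> (pt \<Rightarrow> real) \<Rightarrow> bool" where
  "is_weak_div d \<Omega> q g \<longleftrightarrow>
     (\<forall>K. compactin (euc {..<d}) K \<and> K \<subseteq> \<Omega> \<longrightarrow> integrable (leb d K) g) \<and>
     (\<forall>\<phi>\<in>test_functions d \<Omega>.
        (\<integral>x. (\<Sum>i<d. q x i * partial i \<phi> x) \<partial>leb d \<Omega>) = - (\<integral>x. g x * \<phi> x \<partial>leb d \<Omega>))"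

text \<open>The distribution \<open>div q\<close>, applied to a test function.\<close>

definition div_distr :: "nat \<Rightarrow> pt set \<Rightarrow> (pt \<Rightarrow> nat \<Rightarrow> real) \<Rightarrow> (pt \<Rightarrow> real) \<Rightarrow> real" where
  "div_distr d \<Omega> q \<phi> = - (\<integral>x. (\<Sum>i<d. q x i * partial i \<phi> x) \<partial>leb d \<Omega>)"

text \<open>
  The distribution \<open>\<mu> \<cdot> div J\<close> (row-wise divergence), applied to a test function: multiplying a
  distribution by the functions \<open>\<mu>\<^sub>a\<close> means multiplying the test function by them. This is meaningful
  for \<open>\<mu>\<close> of class \<open>C\<^sup>1\<close> and integrable \<open>J\<close>, since the row divergences are distributions of order one.
\<close>

definition mult_div_distr ::
  "nat \<Rightarrow> nat \<Rightarrow> pt set \<Rightarrow> (pt \<Rightarrow> nat \<Rightarrow> real) \<Rightarrow> (pt \<Rightarrow> nat \<times> nat \<Rightarrow> real) \<Rightarrow> (pt \<Rightarrow> real) \<Rightarrow> real" where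
  "mult_div_distr m d \<Omega> \<mu> J \<phi> =
     (\<Sum>a<m. div_distr d \<Omega> (\<lambda>x i. J x (a, i)) (\<lambda>x. \<mu> x a * \<phi> x))"

section \<open>Port spaces\<close>

text \<open>
  Real topological vector spaces with an explicit carrier; the ring components \<open>mult\<close> and \<open>one\<close> that
  the record \<open>module\<close> inherits are irrelevant.
\<close>

record 'y port_space = "(real, 'y) module" +
  port_topology :: "'y topology"

definition real_ring :: "real ring" where
  "real_ring = \<lparr>carrier = UNIV, mult = (*), one = 1, zero = 0, add = (+)\<rparr>"

definition is_port_space :: "('y, 'z) port_space_scheme \<Rightarrow> bool" where
  "is_port_space Y \<longleftrightarrow>
     Module.module real_ring Y \<and> topspace (port_topology Y) = carrier Y \<and>
     continuous_map (prod_topology (port_topology Y) (port_topology Y)) (port_topology Y)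
       (\<lambda>(y, z). y \<oplus>\<^bsub>Y\<^esub> z) \<and>
     continuous_map (prod_topology euclideanreal (port_topology Y)) (port_topology Y)
       (\<lambda>(a, y). a \<odot>\<^bsub>Y\<^esub> y)"

definition is_port_pairing :: "'e port_space \<Rightarrow> 'f port_space \<Rightarrow> ('e \<times> 'f \<Rightarrow> real) \<Rightarrow> bool" where
  "is_port_pairing Y Z b \<longleftrightarrow>
     b \<in> extensional (carrier Y \<times> carrier Z) \<and>
     continuous_map (prod_topology (port_topology Y) (port_topology Z)) euclideanreal b \<and>
     (\<forall>y\<in>carrier Y. \<forall>y'\<in>carrier Y. \<forall>z\<in>carrier Z. b (y \<oplus>\<^bsub>Y\<^esub> y', z) = b (y, z) + b (y', z)) \<and>
     (\<forall>y\<in>carrier Y. \<forall>z\<in>carrier Z. \<forall>z'\<in>carrier Z. b (y, z \<oplus>\<^bsub>Z\<^esub> z') = b (y, z) + b (y, z')) \<and>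
     (\<forall>a. \<forall>y\<in>carrier Y. \<forall>z\<in>carrier Z.
        b (a \<odot>\<^bsub>Y\<^esub> y, z) = a * b (y, z) \<and> b (y, a \<odot>\<^bsub>Z\<^esub> z) = a * b (y, z))"

section \<open>Open continuum thermodynamic systems\<close>

text \<open>The fields \<open>\<X>\<close> and \<open>\<mu>\<close> of the tuple are determined by the others and are defined below.\<close>

record ('e, 'f) system =
  dim :: nat
  ncomp :: nat
  omega :: "pt set"
  states :: "pt set"
  psi :: "pt \<times> pt \<Rightarrow> real"
  J_rev :: "nat field_class \<Rightarrow> (nat \<times> nat) field_class"
  J_diss :: "nat field_class \<Rightarrow> (nat \<times> nat) field_class"
  source :: "nat field_class \<Rightarrow> nat field_class"
  port_e :: "'e port_space"
  port_f :: "'f port_space"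
  trace_e :: "nat field_class \<Rightarrow> 'e"
  trace_f :: "nat field_class \<Rightarrow> 'f"
  pairing :: "'e \<times> 'f \<Rightarrow> real"

definition cl_omega :: "('e, 'f) system \<Rightarrow> pt set" where
  "cl_omega T = euc {..<dim T} closure_of omega T"

text \<open>
  Joint \<open>C\<^sup>2\<close> regularity on \<open>closure \<Omega> \<times> U\<close>: a pair \<open>(x, u)\<close> is encoded as the single family \<open>z\<close>
  over the disjoint sum of the index sets with \<open>z \<circ> Inl = x\<close> and \<open>z \<circ> Inr = u\<close>.
\<close>

definition is_storage_density :: "('e, 'f) system \<Rightarrow> bool" where
  "is_storage_density T \<longleftrightarrow>
     psi T \<in> extensional (cl_omega T \<times> states T) \<and>
     Ck_upto ({..<dim T} <+> {..<ncomp T}) 2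
       {z \<in> ({..<dim T} <+> {..<ncomp T}) \<rightarrow>\<^sub>E UNIV.
          (\<lambda>i. z (Inl i)) \<in> omega T \<and> (\<lambda>a. z (Inr a)) \<in> states T}
       {z \<in> ({..<dim T} <+> {..<ncomp T}) \<rightarrow>\<^sub>E UNIV.
          (\<lambda>i. z (Inl i)) \<in> cl_omega T \<and> (\<lambda>a. z (Inr a)) \<in> states T}
       (\<lambda>z. psi T (\<lambda>i. z (Inl i), \<lambda>a. z (Inr a))) \<and>
     (\<forall>x\<in>cl_omega T. \<forall>u\<in>states T. \<forall>v\<in>states T. \<forall>t\<in>{0..1}.
        psi T (x, convex_comb (ncomp T) t u v) \<le> (1 - t) * psi T (x, u) + t * psi T (x, v))"

definition admissible_fields :: "('e, 'f) system \<Rightarrow> nat field_class set" where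
  "admissible_fields T =
     {ae_class (dim T) (omega T) {..<ncomp T} u | u.
        u \<in> meas_fields (dim T) (omega T) {..<ncomp T} \<and>
        (\<forall>a<ncomp T. H1_function (dim T) (omega T) (\<lambda>x. u x a)) \<and>
        (AE x in leb (dim T) (omega T). u x \<in> states T) \<and>
        integrable (leb (dim T) (omega T)) (\<lambda>x. psi T (x, u x))}"

definition potential :: "('e, 'f) system \<Rightarrow> (pt \<Rightarrow> pt) \<Rightarrow> pt \<Rightarrow> pt" where
  "potential T u x = (\<lambda>a\<in>{..<ncomp T}. partial a (\<lambda>y. psi T (x, y)) (u x))"

definition free_energy :: "('e, 'f) system \<Rightarrow> nat field_class \<Rightarrow> real" where
  "free_energy T u = (\<integral>x. psi T (x, rep u x) \<partial>leb (dim T) (omega T))"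

definition source_density :: "('e, 'f) system \<Rightarrow> nat field_class \<Rightarrow> pt \<Rightarrow> real" where
  "source_density T u x = (\<Sum>a<ncomp T. potential T (rep u) x a * rep (source T u) x a)"

definition source_contribution :: "('e, 'f) system \<Rightarrow> nat field_class \<Rightarrow> real" where
  "source_contribution T u = (\<integral>x. source_density T u x \<partial>leb (dim T) (omega T))"

definition boundary_exchange :: "('e, 'f) system \<Rightarrow> nat field_class \<Rightarrow> real" where
  "boundary_exchange T u = pairing T (trace_e T u, trace_f T u)"

definition is_constitutive_structure :: "('e, 'f) system \<Rightarrow> bool" where
  "is_constitutive_structure T \<longleftrightarrow>
     J_rev T \<in> admissible_fields T \<rightarrow>\<^sub>E L1 (dim T) (omega T) ({..<ncomp T} \<times> {..<dim T}) \<and>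
     J_diss T \<in> admissible_fields T \<rightarrow>\<^sub>E L1 (dim T) (omega T) ({..<ncomp T} \<times> {..<dim T}) \<and>
     source T \<in> admissible_fields T \<rightarrow>\<^sub>E L1 (dim T) (omega T) {..<ncomp T} \<and>
     is_port_space (port_e T) \<and> is_port_space (port_f T) \<and>
     trace_e T \<in> admissible_fields T \<rightarrow>\<^sub>E carrier (port_e T) \<and>
     trace_f T \<in> admissible_fields T \<rightarrow>\<^sub>E carrier (port_f T) \<and>
     is_port_pairing (port_e T) (port_f T) (pairing T)"

text \<open>
  \<open>v\<close> is the representative of \<open>u\<close> that is \<open>C\<^sup>k\<close> up to the boundary. Its values are required to be
  states on all of the closure, so that the potential is defined up to the boundary as well.
\<close>

definition smooth_rep :: "('e, 'f) system \<Rightarrow> enat \<Rightarrow> nat field_class \<Rightarrow> (pt \<Rightarrow> pt) \<Rightarrow> bool" where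
  "smooth_rep T k u v \<longleftrightarrow>
     v \<in> u \<and> (\<forall>x\<in>cl_omega T. v x \<in> states T) \<and>
     (\<forall>a<ncomp T. Ck_upto {..<dim T} k (omega T) (cl_omega T) (\<lambda>x. v x a))"

text \<open>
  The conditions on \<open>q\<^sup>r\<^sup>e\<^sup>v[u]\<close>, \<open>q\<^sup>d\<^sup>i\<^sup>s\<^sup>s[u]\<close>, \<open>\<sigma>[u]\<close> at one smooth field \<open>u\<close>. The surface integral
  refers to the representative of the total flux that is continuous up to the boundary.
\<close>

definition thermo_conditions ::
  "('e, 'f) system \<Rightarrow> nat field_class \<Rightarrow> (pt \<Rightarrow> pt) \<Rightarrow>
   nat field_class \<Rightarrow> nat field_class \<Rightarrow> unit field_class \<Rightarrow> bool" where
  "thermo_conditions T u v qr qd s \<longleftrightarrow>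
     (\<forall>\<phi>\<in>test_functions (dim T) (omega T).
        mult_div_distr (ncomp T) (dim T) (omega T) (potential T v) (rep (J_rev T u)) \<phi>
          = div_distr (dim T) (omega T) (rep qr) \<phi>) \<and>
     (\<forall>\<phi>\<in>test_functions (dim T) (omega T).
        mult_div_distr (ncomp T) (dim T) (omega T) (potential T v) (rep (J_diss T u)) \<phi>
          = div_distr (dim T) (omega T) (rep qd) \<phi>
            + (\<integral>x. rep s x () * \<phi> x \<partial>leb (dim T) (omega T))) \<and>
     (AE x in leb (dim T) (omega T). rep s x () \<ge> 0) \<and>
     (\<exists>q. (\<forall>i<dim T. continuous_map (subtopology (euc {..<dim T}) (cl_omega T)) euclideanreal
                       (\<lambda>x. q x i)) \<and>
          (AE x in leb (dim T) (omega T). \<forall>i<dim T. q x i = rep qr x i + rep qd x i) \<and>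
          - boundary_flux (dim T) (omega T) q = boundary_exchange T u) \<and>
     integrable (leb (dim T) (omega T)) (source_density T u)"

definition admissibility_maps ::
  "('e, 'f) system \<Rightarrow> enat \<Rightarrow> (nat field_class \<Rightarrow> nat field_class) \<Rightarrow>
   (nat field_class \<Rightarrow> nat field_class) \<Rightarrow> (nat field_class \<Rightarrow> unit field_class) \<Rightarrow> bool" where
  "admissibility_maps T k qr qd s \<longleftrightarrow>
     qr \<in> admissible_fields T \<rightarrow> L1 (dim T) (omega T) {..<dim T} \<and>
     qd \<in> admissible_fields T \<rightarrow> L1 (dim T) (omega T) {..<dim T} \<and>
     s \<in> admissible_fields T \<rightarrow> L1 (dim T) (omega T) UNIV \<and>
     (\<forall>u\<in>admissible_fields T. \<forall>v. smooth_rep T k u v \<longrightarrow>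
        thermo_conditions T u v (qr u) (qd u) (s u))"

text \<open>
  ``Sufficiently smooth'' means \<open>C\<^sup>k\<close> up to the boundary for some order \<open>k\<close> that is large enough for
  the given system; \<open>k \<ge> 1\<close> is needed for the distributional products to make sense.
\<close>

definition sufficient_order :: "('e, 'f) system \<Rightarrow> enat \<Rightarrow> bool" where
  "sufficient_order T k \<longleftrightarrow> 1 \<le> k \<and> (\<exists>qr qd s. admissibility_maps T k qr qd s)"

definition thermodynamically_admissible :: "('e, 'f) system \<Rightarrow> bool" where
  "thermodynamically_admissible T \<longleftrightarrow> (\<exists>k. sufficient_order T k)"

definition thermo_systems :: "('e, 'f) system set" where
  "thermo_systems =
     {T. lipschitz_domain (dim T) (omega T) \<and>
         ncomp T \<ge> 1 \<and> open_convex_state_set (ncomp T) (states T) \<and>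
         is_storage_density T \<and> is_constitutive_structure T \<and> thermodynamically_admissible T}"

text \<open>
  Every larger order is sufficient as well, so a field is sufficiently smooth iff it is of the least
  sufficient order.
\<close>

definition smoothness_order :: "('e, 'f) system \<Rightarrow> enat" where
  "smoothness_order T = (LEAST k. sufficient_order T k)"

text \<open>
  The maps \<open>q\<^sup>r\<^sup>e\<^sup>v\<close>, \<open>q\<^sup>d\<^sup>i\<^sup>s\<^sup>s\<close>, \<open>\<sigma>\<close> are not part of the system, so one admissible \<open>\<sigma>\<close> is selected. On
  sufficiently smooth fields the resulting dissipation does not depend on the selection: adding the
  two balance laws and testing with cut-off functions increasing to 1 expresses the integral of \<open>\<sigma>\<close>
  through \<open>\<mu>\<close>, the fluxes and the boundary exchange.
\<close>

definition entropy_production :: "('e, 'f) system \<Rightarrow> nat field_class \<Rightarrow> unit field_class" where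
  "entropy_production T =
     (SOME s. \<exists>qr qd. admissibility_maps T (smoothness_order T) qr qd s)"

definition dissipation :: "('e, 'f) system \<Rightarrow> nat field_class \<Rightarrow> real" where
  "dissipation T u = (\<integral>x. rep (entropy_production T u) x () \<partial>leb (dim T) (omega T))"

section \<open>Smooth admissible trajectories\<close>

text \<open>
  \<open>v t\<close> is the smooth representative of \<open>u t\<close>, whereas \<open>w\<close> and \<open>r\<close> are jointly measurable
  representatives of the divergence of the total flux and of the source.
\<close>

definition smooth_trajectory :: "('e, 'f) system \<Rightarrow> real \<Rightarrow> (real \<Rightarrow> nat field_class) \<Rightarrow> bool" where
  "smooth_trajectory T \<tau> u \<longleftrightarrow>
     u \<in> {0..\<tau>} \<rightarrow>\<^sub>E admissible_fields T \<and>
     (\<exists>v w r.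
        (\<forall>t\<in>{0..\<tau>}. smooth_rep T (smoothness_order T) (u t) (v t)) \<and>
        (\<forall>a<ncomp T.
           continuous_map
             (prod_topology (top_of_set {0..\<tau>}) (subtopology (euc {..<dim T}) (cl_omega T)))
             euclideanreal (\<lambda>(t, x). v t x a)) \<and>
        (\<forall>a<ncomp T. \<forall>t\<in>{0<..<\<tau>}. \<forall>x\<in>omega T. (\<lambda>s. v s x a) differentiable (at t)) \<and>
        (\<forall>a<ncomp T. (\<lambda>(t, x). w t x a) \<in>
           borel_measurable (lebesgue_on {0<..<\<tau>} \<Otimes>\<^sub>M leb (dim T) (omega T))) \<and>
        (\<forall>a<ncomp T. (\<lambda>(t, x). r t x a) \<in>
           borel_measurable (lebesgue_on {0<..<\<tau>} \<Otimes>\<^sub>M leb (dim T) (omega T))) \<and>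
        (AE t in lebesgue_on {0<..<\<tau>}. \<forall>a<ncomp T.
           is_weak_div (dim T) (omega T)
             (\<lambda>x i. rep (J_rev T (u t)) x (a, i) + rep (J_diss T (u t)) x (a, i))
             (\<lambda>x. w t x a)) \<and>
        (AE t in lebesgue_on {0<..<\<tau>}. r t \<in> source T (u t)) \<and>
        (AE (t, x) in lebesgue_on {0<..<\<tau>} \<Otimes>\<^sub>M leb (dim T) (omega T). \<forall>a<ncomp T.
           deriv (\<lambda>s. v s x a) t + w t x a = r t x a))"

section \<open>Exact thermodynamic morphisms\<close>

record ('e, 'f) morphism =
  field_map :: "nat field_class \<Rightarrow> nat field_class"
  map_e :: "'e \<Rightarrow> 'e"
  map_f :: "'f \<Rightarrow> 'f"

definition exact_morphisms ::
  "('e, 'f) system \<Rightarrow> ('e, 'f) system \<Rightarrow> ('e, 'f) morphism set" where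
  "exact_morphisms T1 T2 =
     {\<Phi>. field_map \<Phi> \<in> admissible_fields T1 \<rightarrow>\<^sub>E admissible_fields T2 \<and>
         map_e \<Phi> \<in> carrier (port_e T1) \<rightarrow>\<^sub>E carrier (port_e T2) \<and>
         map_f \<Phi> \<in> carrier (port_f T1) \<rightarrow>\<^sub>E carrier (port_f T2) \<and>
         (\<forall>\<tau>>0. \<forall>u. smooth_trajectory T1 \<tau> u \<longrightarrow>
            (let u' = compose {0..\<tau>} (field_map \<Phi>) u in
               smooth_trajectory T2 \<tau> u' \<and>
               (\<forall>t\<in>{0..\<tau>}.
                  free_energy T2 (u' t) = free_energy T1 (u t) \<and>
                  dissipation T2 (u' t) = dissipation T1 (u t) \<and>
                  source_contribution T2 (u' t) = source_contribution T1 (u t) \<and>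
                  trace_e T2 (u' t) = map_e \<Phi> (trace_e T1 (u t)) \<and>
                  trace_f T2 (u' t) = map_f \<Phi> (trace_f T1 (u t))))) \<and>
         (\<forall>\<eta>\<in>carrier (port_e T1). \<forall>\<zeta>\<in>carrier (port_f T1).
            pairing T2 (map_e \<Phi> \<eta>, map_f \<Phi> \<zeta>) = pairing T1 (\<eta>, \<zeta>))}"

definition morphism_id :: "('e, 'f) system \<Rightarrow> ('e, 'f) morphism" where
  "morphism_id T =
     \<lparr>field_map = (\<lambda>u\<in>admissible_fields T. u),
      map_e = (\<lambda>\<eta>\<in>carrier (port_e T). \<eta>),
      map_f = (\<lambda>\<zeta>\<in>carrier (port_f T). \<zeta>)\<rparr>"

text \<open>
  The composite of \<open>\<Phi> : T1 \<rightarrow> T2\<close> and \<open>\<Psi> : T2 \<rightarrow> T3\<close>; its source is needed since all maps are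
  extensional.
\<close>

definition morphism_comp ::
  "('e, 'f) system \<Rightarrow> ('e, 'f) system \<Rightarrow> ('e, 'f) system \<Rightarrow>
   ('e, 'f) morphism \<Rightarrow> ('e, 'f) morphism \<Rightarrow>
   ('e, 'f) morphism" where
  "morphism_comp T1 T2 T3 \<Psi> \<Phi> =
     \<lparr>field_map = compose (admissible_fields T1) (field_map \<Psi>) (field_map \<Phi>),
      map_e = compose (carrier (port_e T1)) (map_e \<Psi>) (map_e \<Phi>),
      map_f = compose (carrier (port_f T1)) (map_f \<Psi>) (map_f \<Phi>)\<rparr>"

section \<open>Categories\<close>

locale category =
  fixes Obj :: "'o set"
    and Hom :: "'o \<Rightarrow> 'o \<Rightarrow> 'm set"
    and Comp :: "'o \<Rightarrow> 'o \<Rightarrow> 'o \<Rightarrow> 'm \<Rightarrow> 'm \<Rightarrow> 'm"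
    and Id :: "'o \<Rightarrow> 'm"
  assumes Id_in_Hom: "A \<in> Obj \<Longrightarrow> Id A \<in> Hom A A"
    and Comp_in_Hom:
      "\<lbrakk>A \<in> Obj; B \<in> Obj; C \<in> Obj; f \<in> Hom A B; g \<in> Hom B C\<rbrakk> \<Longrightarrow> Comp A B C g f \<in> Hom A C"
    and Comp_Id_right: "\<lbrakk>A \<in> Obj; B \<in> Obj; f \<in> Hom A B\<rbrakk> \<Longrightarrow> Comp A A B f (Id A) = f"
    and Comp_Id_left: "\<lbrakk>A \<in> Obj; B \<in> Obj; f \<in> Hom A B\<rbrakk> \<Longrightarrow> Comp A B B (Id B) f = f"
    and Comp_assoc:
      "\<lbrakk>A \<in> Obj; B \<in> Obj; C \<in> Obj; D \<in> Obj; f \<in> Hom A B; g \<in> Hom B C; h \<in> Hom C D\<rbrakk> \<Longrightarrow>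
         Comp A C D h (Comp A B C g f) = Comp A B D (Comp B C D h g) f"

end

theory Submission
  imports Defs
begin

text \<open>
  A morphism is a triple of extensional maps between carrier sets, and such maps with \<open>compose\<close> and
  restricted identities satisfy the category laws. What has to be shown is that exactness survives
  the formation of identities and composites. Every exactness condition equates a quantity of the
  transformed trajectory with one of the original, and smooth admissible trajectories of \<open>T1\<close> are
  carried to smooth admissible trajectories of \<open>T2\<close>; so for \<open>T1 \<rightarrow> T2 \<rightarrow> T3\<close> the second morphism may
  be evaluated on the image of a trajectory under the first, and the two sets of equations chain.
  This rests on \<open>compose_field_map_comp\<close>: transforming by a composite is transforming twice.
  Port maps are restricted to the port spaces; the trace equations therefore chain because the traces
  of a system take values in these spaces. Port maps also send port spaces to port spaces, so the
  pairing identities chain as well.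
\<close>

text \<open>
  Trajectories are extensional in time and take admissible values, so restricting field maps to the
  admissible fields does not affect the action on a trajectory.
\<close>

lemma compose_field_map_id:
  assumes "smooth_trajectory T \<tau> u"
  shows "compose {0..\<tau>} (field_map (morphism_id T)) u = u"
  using assms
  by (auto simp: smooth_trajectory_def morphism_id_def compose_def restrict_def PiE_iff
      extensional_def fun_eq_iff)

lemma compose_field_map_comp:
  assumes "smooth_trajectory T1 \<tau> u"
  shows "compose {0..\<tau>} (field_map (morphism_comp T1 T2 T3 \<Psi> \<Phi>)) u =
    compose {0..\<tau>} (field_map \<Psi>) (compose {0..\<tau>} (field_map \<Phi>) u)"
  using assms
  by (auto simp: smooth_trajectory_def morphism_comp_def compose_def restrict_def PiE_iff
      fun_eq_iff)

lemma traces_in_ports: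
  assumes "T \<in> thermo_systems" "u \<in> admissible_fields T"
  shows "trace_e T u \<in> carrier (port_e T)" "trace_f T u \<in> carrier (port_f T)"
  using assms by (auto simp: thermo_systems_def is_constitutive_structure_def)

lemma smooth_trajectory_admissible:
  assumes "smooth_trajectory T \<tau> u" "t \<in> {0..\<tau>}"
  shows "u t \<in> admissible_fields T"
  using assms by (auto simp: smooth_trajectory_def)

lemma exact_morphism_maps:
  assumes "\<Phi> \<in> exact_morphisms T1 T2"
  shows "field_map \<Phi> \<in> admissible_fields T1 \<rightarrow>\<^sub>E admissible_fields T2"
    and "map_e \<Phi> \<in> carrier (port_e T1) \<rightarrow>\<^sub>E carrier (port_e T2)"
    and "map_f \<Phi> \<in> carrier (port_f T1) \<rightarrow>\<^sub>E carrier (port_f T2)"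
  using assms by (auto simp: exact_morphisms_def)

lemma exact_morphism_pairing:
  assumes "\<Phi> \<in> exact_morphisms T1 T2"
    and "\<eta> \<in> carrier (port_e T1)" "\<zeta> \<in> carrier (port_f T1)"
  shows "pairing T2 (map_e \<Phi> \<eta>, map_f \<Phi> \<zeta>) = pairing T1 (\<eta>, \<zeta>)"
  using assms by (auto simp: exact_morphisms_def)

lemma exact_morphism_trajectory:
  assumes "\<Phi> \<in> exact_morphisms T1 T2" "\<tau> > 0" "smooth_trajectory T1 \<tau> u"
  shows "smooth_trajectory T2 \<tau> (compose {0..\<tau>} (field_map \<Phi>) u)"
  using assms by (auto simp: exact_morphisms_def Let_def)

lemma exact_morphism_quantities:
  assumes "\<Phi> \<in> exact_morphisms T1 T2" "\<tau> > 0" "smooth_trajectory T1 \<tau> u" "t \<in> {0..\<tau>}"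
  defines "u' \<equiv> compose {0..\<tau>} (field_map \<Phi>) u"
  shows "free_energy T2 (u' t) = free_energy T1 (u t)"
    and "dissipation T2 (u' t) = dissipation T1 (u t)"
    and "source_contribution T2 (u' t) = source_contribution T1 (u t)"
    and "trace_e T2 (u' t) = map_e \<Phi> (trace_e T1 (u t))"
    and "trace_f T2 (u' t) = map_f \<Phi> (trace_f T1 (u t))"
  using assms by (auto simp: exact_morphisms_def Let_def)

text \<open>
  An identity fixes every trajectory, so the conditions on trajectories become reflexivity, except
  that the identity port maps are genuine identities only on values in the port spaces.
\<close>

lemma morphism_id_exact:
  assumes "T \<in> thermo_systems"
  shows "morphism_id T \<in> exact_morphisms T T"
proof -
  have "trace_e T (u t) = map_e (morphism_id T) (trace_e T (u t)) \<and>
      trace_f T (u t) = map_f (morphism_id T) (trace_f T (u t))"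
    if "smooth_trajectory T \<tau> u" "t \<in> {0..\<tau>}" for \<tau> u t
    using traces_in_ports[OF assms smooth_trajectory_admissible[OF that]]
    by (simp add: morphism_id_def)
  moreover have "field_map (morphism_id T) \<in> admissible_fields T \<rightarrow>\<^sub>E admissible_fields T"
    "map_e (morphism_id T) \<in> carrier (port_e T) \<rightarrow>\<^sub>E carrier (port_e T)"
    "map_f (morphism_id T) \<in> carrier (port_f T) \<rightarrow>\<^sub>E carrier (port_f T)"
    "\<forall>\<eta>\<in>carrier (port_e T). \<forall>\<zeta>\<in>carrier (port_f T).
      pairing T (map_e (morphism_id T) \<eta>, map_f (morphism_id T) \<zeta>) = pairing T (\<eta>, \<zeta>)"
    by (auto simp: morphism_id_def)
  ultimately show ?thesis
    by (simp add: exact_morphisms_def Let_def compose_field_map_id)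
qed

text \<open>
  The image of a trajectory under \<open>\<Phi>\<close> is a trajectory of \<open>T2\<close>, to which the exactness of \<open>\<Psi>\<close>
  applies; this is why preservation of trajectories has to be part of exactness.
\<close>

lemma morphism_comp_exact:
  assumes T1: "T1 \<in> thermo_systems"
    and \<Phi>: "\<Phi> \<in> exact_morphisms T1 T2" and \<Psi>: "\<Psi> \<in> exact_morphisms T2 T3"
  shows "morphism_comp T1 T2 T3 \<Psi> \<Phi> \<in> exact_morphisms T1 T3"
proof -
  let ?C = "morphism_comp T1 T2 T3 \<Psi> \<Phi>"
  note maps = exact_morphism_maps[OF \<Phi>] exact_morphism_maps[OF \<Psi>]
  have "field_map ?C \<in> admissible_fields T1 \<rightarrow>\<^sub>E admissible_fields T3"
    "map_e ?C \<in> carrier (port_e T1) \<rightarrow>\<^sub>E carrier (port_e T3)"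
    "map_f ?C \<in> carrier (port_f T1) \<rightarrow>\<^sub>E carrier (port_f T3)"
    using maps by (auto simp: morphism_comp_def compose_def)
  moreover have "pairing T3 (map_e ?C \<eta>, map_f ?C \<zeta>) = pairing T1 (\<eta>, \<zeta>)"
    if "\<eta> \<in> carrier (port_e T1)" "\<zeta> \<in> carrier (port_f T1)" for \<eta> \<zeta>
  proof -
    have "map_e \<Phi> \<eta> \<in> carrier (port_e T2)" "map_f \<Phi> \<zeta> \<in> carrier (port_f T2)"
      using maps that by auto
    from exact_morphism_pairing[OF \<Psi> this] exact_morphism_pairing[OF \<Phi> that] that
    show ?thesis by (simp add: morphism_comp_def compose_eq)
  qed
  moreover have "smooth_trajectory T3 \<tau> (compose {0..\<tau>} (field_map ?C) u) \<and>
      (\<forall>t\<in>{0..\<tau>}.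
        free_energy T3 (compose {0..\<tau>} (field_map ?C) u t) = free_energy T1 (u t) \<and>
        dissipation T3 (compose {0..\<tau>} (field_map ?C) u t) = dissipation T1 (u t) \<and>
        source_contribution T3 (compose {0..\<tau>} (field_map ?C) u t) = source_contribution T1 (u t) \<and>
        trace_e T3 (compose {0..\<tau>} (field_map ?C) u t) = map_e ?C (trace_e T1 (u t)) \<and>
        trace_f T3 (compose {0..\<tau>} (field_map ?C) u t) = map_f ?C (trace_f T1 (u t)))"
    if \<tau>: "\<tau> > 0" and u: "smooth_trajectory T1 \<tau> u" for \<tau> u
  proof -
    note u' = exact_morphism_trajectory[OF \<Phi> \<tau> u]
    have "map_e ?C (trace_e T1 (u t)) = map_e \<Psi> (map_e \<Phi> (trace_e T1 (u t)))"
      "map_f ?C (trace_f T1 (u t)) = map_f \<Psi> (map_f \<Phi> (trace_f T1 (u t)))"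
      if "t \<in> {0..\<tau>}" for t
      using traces_in_ports[OF T1 smooth_trajectory_admissible[OF u that]]
      by (simp_all add: morphism_comp_def compose_eq)
    then show ?thesis
      unfolding compose_field_map_comp[OF u]
      using exact_morphism_trajectory[OF \<Psi> \<tau> u'] exact_morphism_quantities[OF \<Psi> \<tau> u']
        exact_morphism_quantities[OF \<Phi> \<tau> u]
      by simp
  qed
  ultimately show ?thesis
    by (simp add: exact_morphisms_def Let_def)
qed

lemma morphism_comp_id_right:
  assumes "\<Phi> \<in> exact_morphisms T1 T2"
  shows "morphism_comp T1 T1 T2 \<Phi> (morphism_id T1) = \<Phi>"
  using exact_morphism_maps[OF assms]
  by (cases \<Phi>) (simp add: morphism_comp_def morphism_id_def PiE_iff compose_Id[where B = UNIV])

lemma morphism_comp_id_left: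
  assumes "\<Phi> \<in> exact_morphisms T1 T2"
  shows "morphism_comp T1 T2 T2 (morphism_id T2) \<Phi> = \<Phi>"
  using exact_morphism_maps[OF assms]
  by (cases \<Phi>) (simp add: morphism_comp_def morphism_id_def PiE_iff Id_compose Pi_iff)

lemma morphism_comp_assoc:
  assumes "\<Phi> \<in> exact_morphisms T1 T2"
  shows "morphism_comp T1 T3 T4 \<Xi> (morphism_comp T1 T2 T3 \<Psi> \<Phi>) =
    morphism_comp T1 T2 T4 (morphism_comp T2 T3 T4 \<Xi> \<Psi>) \<Phi>"
  using exact_morphism_maps[OF assms]
  by (simp add: morphism_comp_def PiE_iff Pi_iff compose_assoc)

theorem proposition3p3:
  shows "category (thermo_systems :: ('e, 'f) system set) exact_morphisms morphism_comp morphism_id"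
  by unfold_locales
    (simp_all add: morphism_id_exact morphism_comp_exact morphism_comp_id_right
      morphism_comp_id_left morphism_comp_assoc)

end
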